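(* Let $\Sigma\in\mathbb{R}^{n\times n}$ be symmetric positive semidefinite with eigendecomposition $\Sigma=V\Lambda V^T$, where $V$ is orthogonal, $\Lambda=\operatorname{diag}(\lambda_1,\dots,\lambda_n)$ and $\lambda_1\ge\cdots\ge\lambda_n\ge 0$. Fix an integer $0\le k\le n$ and write $V=[V_k\;\;V_{>k}]$ (first $k$ columns and remaining $n-k$ columns) and $\Lambda=\operatorname{diag}(\Lambda_k,\Lambda_{>k})$ accordingly. Define $$U_k=V_k\Lambda_k^{1/2},\qquad D_k=\operatorname{diag}\bigl(\Sigma_{ii}-(U_kU_k^T)_{ii}\bigr)_{i=1}^n,$$ $$S_k=\Sigma-U_kU_k^T=V_{>k}\Lambda_{>k}V_{>k}^T\succeq 0,\qquad R_k=\Sigma-(D_k+U_kU_k^T)=S_k-D_k.$$ Then: (1) $\Sigma=D_k+U_kU_k^T+R_k$, with $D_k\succeq 0$. (2) $\|S_k\|_2=\lambda_{k+1}$ and $\|R_k\|_2\le\lambda_{k+1}$, with strict inequality $\|R_k\|_2<\lambda_{k+1}$ whenever $\lambda_{k+1}>0$. (3) If $\lambda_{k+1}=0$ (i.e. $\operatorname{rank}\Sigma\le k$), then $D_k=0$ and $R_k=0$, so $\Sigma=U_kU_k^T$. In particular, whenever $\operatorname{rank}\Sigma>k$, including $D_k$ strictly reduces the operator-norm error compared with the pure rank-$k$ approximation, i.e. $\|\Sigma-(D_k+U_kU_k^T)\|_2<\|\Sigma-U_kU_k^T\|_2$.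
   Context: $\|\cdot\|_2$ is the spectral (operator) norm, and $\operatorname{diag}(x_i)_{i=1}^n$ denotes the diagonal matrix with entries $x_1,\dots,x_n$. $X\succeq 0$ means $X$ is symmetric positive semidefinite. Convention: $\lambda_{n+1}:=0$ (used when $k=n$), and empty products $U_kU_k^T$ are zero when $k=0$. *)

theory Defs
  imports Complex_Main "Jordan_Normal_Form.Matrix" "Jordan_Normal_Form.DL_Rank"
begin

(* The library's orthogonal_mat only asks for pairwise orthogonal nonzero columns,
   not for unit columns, so it is not the notion needed here. *)
definition orthonormal_mat :: "nat \<Rightarrow> real mat \<Rightarrow> bool" where
  "orthonormal_mat n V \<longleftrightarrow>
     V \<in> carrier_mat n n \<and>
     transpose_mat V * V = 1\<^sub>m n \<and> V * transpose_mat V = 1\<^sub>m n"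

definition psd_mat :: "nat \<Rightarrow> real mat \<Rightarrow> bool" where
  "psd_mat n A \<longleftrightarrow>
     A \<in> carrier_mat n n \<and> transpose_mat A = A \<and>
     (\<forall>x \<in> carrier_vec n. 0 \<le> x \<bullet> (A *\<^sub>v x))"

definition vec_norm2 :: "real vec \<Rightarrow> real" where
  "vec_norm2 x = sqrt (x \<bullet> x)"

(* The supremum is over the closed unit ball rather than the unit sphere, so that the
   set is nonempty (and the norm 0) also for a matrix without columns. *)
definition spectral_norm :: "real mat \<Rightarrow> real" where
  "spectral_norm A =
     (SUP x \<in> {x \<in> carrier_vec (dim_col A). vec_norm2 x \<le> 1}. vec_norm2 (A *\<^sub>v x))"

definition left_cols :: "nat \<Rightarrow> real mat \<Rightarrow> real mat" where
  "left_cols k A = mat_of_cols (dim_row A) (take k (cols A))"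

definition right_cols :: "nat \<Rightarrow> real mat \<Rightarrow> real mat" where
  "right_cols k A = mat_of_cols (dim_row A) (drop k (cols A))"

(* Eigenvalues are indexed from 0, like matrix entries: the mathematical
   lambda_1, ..., lambda_n are l 0, ..., l (n - 1). Hence lambda_(k+1), with the
   convention lambda_(n+1) = 0, is next_eigenvalue n l k. *)
definition next_eigenvalue :: "nat \<Rightarrow> (nat \<Rightarrow> real) \<Rightarrow> nat \<Rightarrow> real" where
  "next_eigenvalue n l k = (if k < n then l k else 0)"

end

theory Submission
  imports Defs
begin

text \<open>The strict inequality rests on the following observation. Write \<open>c\<close> for the largest
  eigenvalue of \<open>S\<close>. Both \<open>S\<close> and \<open>c I - S\<close> are positive semidefinite, so a row of \<open>S\<close> whose
  diagonal entry is \<open>0\<close> or \<open>c\<close> vanishes off the diagonal, and the corresponding row and column of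
  \<open>R = S - D\<close> are zero. On the remaining coordinates the diagonal entries of \<open>S\<close> lie strictly
  between \<open>0\<close> and \<open>c\<close>, and \<open>- D \<preceq> R \<preceq> c I - D\<close> confines the quadratic form of \<open>R\<close> to
  \<open>[-b, b]\<close> on unit vectors for some \<open>b < c\<close>; no compactness argument is needed.\<close>

section \<open>Rank of products\<close>

context vec_space
begin

lemma mult_mat_vec_in_span_cols:
  assumes A: "A \<in> carrier_mat n nc" and v: "v \<in> carrier_vec nc"
  shows "A *\<^sub>v v \<in> span (set (cols A))"
proof -
  have cols: "set (cols A) \<subseteq> carrier_vec n"
    using A cols_dim by blast
  have "A *\<^sub>v v = mat_of_cols n (cols A) *\<^sub>v v"
    using A by (metis carrier_matD(1) mat_of_cols_cols)
  also have "\<dots> = mat_of_cols n (cols A) *\<^sub>v vec (length (cols A)) (($) v)"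
    using A v by (metis carrier_matD(2) carrier_vecD cols_length eq_vecI index_vec dim_vec)
  also have "\<dots> = lincomb_list (($) v) (cols A)"
    using lincomb_list_as_mat_mult[of "cols A" "($) v"] cols carrier_vecD by fastforce
  also have "\<dots> \<in> span_list (cols A)"
    by (rule in_span_listI) auto
  finally show ?thesis
    using span_list_as_span cols by auto
qed

text \<open>The rank is the dimension of the column span, and each column of \<open>A * C\<close> is
  \<open>A\<close> applied to a column of \<open>C\<close>, so the column span of the product lies
  inside that of \<open>A\<close>.\<close>

lemma rank_mult_le:
  assumes A: "A \<in> carrier_mat n m" and C: "C \<in> carrier_mat m nc"
  shows "rank (A * C) \<le> rank A"
proof -
  define W where "W = span (set (cols A))"
  have AC: "A * C \<in> carrier_mat n nc"
    using A C by simp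
  have W: "subspace class_ring W V" and fin_W: "vectorspace.fin_dim class_ring (vs W)"
    using A cols_dim span_is_subspace fin_dim_span_cols by (auto simp: W_def)
  have "set (cols (A * C)) \<subseteq> W"
  proof
    fix x assume "x \<in> set (cols (A * C))"
    then obtain j where j: "j < nc" "x = col (A * C) j"
      using AC by (auto simp: cols_def)
    then have "x = A *\<^sub>v col C j"
      using A C by (metis col_mult2)
    then show "x \<in> W"
      unfolding W_def using A C j mult_mat_vec_in_span_cols by simp
  qed
  then have "span (set (cols (A * C))) \<subseteq> W"
    using W by (simp add: span_is_subset subspace_def)
  moreover have "subspace class_ring (span (set (cols (A * C)))) V"
    using AC cols_dim span_is_subspace by (metis carrier_matD(1))
  ultimately have "subspace class_ring (span (set (cols (A * C)))) (vs W)"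
    using nested_subspaces[OF W] by blast
  moreover have "vectorspace.fin_dim class_ring (span_vs (set (cols (A * C))))"
    using AC fin_dim_span_cols by blast
  ultimately show ?thesis
    unfolding rank_def W_def[symmetric]
    using vectorspace.subspace_dim[OF subspace_is_vs[OF W] _ fin_W] by auto
qed

text \<open>A left inverse makes \<open>v \<mapsto> A v\<close> injective, which rules out both
  coinciding columns and a nontrivial linear relation between them.\<close>

lemma rank_left_invertible:
  assumes A: "A \<in> carrier_mat n nc" and B: "B \<in> carrier_mat nc n" and BA: "B * A = 1\<^sub>m nc"
  shows "rank A = nc"
proof -
  \<comment> \<open>Linear independence is stated for the set of columns, where a repeated column
    would go unnoticed; distinctness is therefore shown on its own.\<close>
  have dist: "distinct (cols A)"
  proof (unfold distinct_conv_nth, intro allI impI)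
    fix i j assume "i < length (cols A)" "j < length (cols A)" "i \<noteq> j"
    then have ij: "i < nc" "j < nc" "i \<noteq> j"
      using A by auto
    have "col (1\<^sub>m nc) i = B *\<^sub>v col A i" "col (1\<^sub>m nc) j = B *\<^sub>v col A j"
      using col_mult2[OF B A] ij BA by metis+
    moreover have "col (1\<^sub>m nc) i $ i \<noteq> (col (1\<^sub>m nc) j $ i :: 'a)"
      using ij by simp
    ultimately show "cols A ! i \<noteq> cols A ! j"
      using A ij by auto
  qed
  moreover have "lin_indpt (set (cols A))"
  proof
    assume "lin_dep (set (cols A))"
    then obtain v where v: "v \<in> carrier_vec nc" "v \<noteq> 0\<^sub>v nc" "A *\<^sub>v v = 0\<^sub>v n"
      using lin_depE[OF A _ dist] by blast
    have "v = (B * A) *\<^sub>v v"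
      using v by (simp add: BA)
    also have "\<dots> = B *\<^sub>v 0\<^sub>v n"
      using assoc_mult_mat_vec[OF B A v(1)] v(3) by simp
    also have "\<dots> = 0\<^sub>v nc"
      using B by auto
    finally show False
      using v by simp
  qed
  ultimately show ?thesis
    using lin_indpt_full_rank[OF A] by blast
qed

end

section \<open>Spectral norm and quadratic forms\<close>

lemma scalar_prod_self_nonneg: "0 \<le> x \<bullet> (x :: real vec)"
  by (simp add: scalar_prod_def sum_nonneg)

lemma vec_norm2_nonneg: "0 \<le> vec_norm2 x"
  by (simp add: vec_norm2_def scalar_prod_self_nonneg)

lemma vec_norm2_le_1_iff: "vec_norm2 x \<le> 1 \<longleftrightarrow> x \<bullet> x \<le> 1"
  by (simp add: vec_norm2_def)

lemma spectral_norm_leI: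
  assumes "A \<in> carrier_mat m n"
    and "\<And>x. x \<in> carrier_vec n \<Longrightarrow> x \<bullet> x \<le> 1 \<Longrightarrow> vec_norm2 (A *\<^sub>v x) \<le> c"
  shows "spectral_norm A \<le> c"
proof -
  have "0\<^sub>v n \<in> {x \<in> carrier_vec (dim_col A). vec_norm2 x \<le> 1}"
    using assms(1) by (simp add: vec_norm2_def)
  then show ?thesis
    unfolding spectral_norm_def
    using assms by (intro cSUP_least) (blast, auto simp: vec_norm2_le_1_iff)
qed

text \<open>The constant \<open>c\<close> only witnesses that the supremum is over a bounded set; it
  does not enter the conclusion.\<close>

lemma spectral_norm_geI:
  assumes "A \<in> carrier_mat m n"
    and "\<And>x. x \<in> carrier_vec n \<Longrightarrow> x \<bullet> x \<le> 1 \<Longrightarrow> vec_norm2 (A *\<^sub>v x) \<le> c"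
    and "x \<in> carrier_vec n" "x \<bullet> x \<le> 1"
  shows "vec_norm2 (A *\<^sub>v x) \<le> spectral_norm A"
  unfolding spectral_norm_def
  using assms by (intro cSUP_upper bdd_aboveI2[where M = c]) (auto simp: vec_norm2_le_1_iff)

lemma spectral_norm_zero_mat: "spectral_norm (0\<^sub>m m n) = 0"
proof (rule antisym)
  have norm: "vec_norm2 (0\<^sub>m m n *\<^sub>v x) = 0" if "x \<in> carrier_vec n" for x
    using that by (simp add: vec_norm2_def scalar_prod_def)
  then show "spectral_norm (0\<^sub>m m n) \<le> 0"
    by (intro spectral_norm_leI[of _ m n]) auto
  show "0 \<le> spectral_norm (0\<^sub>m m n)"
    using spectral_norm_geI[of "0\<^sub>m m n" m n 0 "0\<^sub>v n"] norm by simp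
qed

lemma symmetric_bilinear_comm:
  fixes A :: "'a :: comm_semiring_0 mat"
  assumes "A \<in> carrier_mat n n" "transpose_mat A = A" "x \<in> carrier_vec n" "y \<in> carrier_vec n"
  shows "y \<bullet> (A *\<^sub>v x) = x \<bullet> (A *\<^sub>v y)"
  using transpose_vec_mult_scalar[OF assms(1,3,4)] assms
  by (metis comm_scalar_prod mult_mat_vec_carrier)

text \<open>By polarization and the parallelogram law, a two-sided bound on the quadratic form of a
  symmetric matrix bounds its bilinear form, which is then evaluated at \<open>x\<close> and \<open>A x\<close>.\<close>

lemma vec_norm2_mult_le_of_quadratic_form:
  assumes A: "A \<in> carrier_mat n n" and sym: "transpose_mat A = A"
    and bound: "\<And>x. x \<in> carrier_vec n \<Longrightarrow> \<bar>x \<bullet> (A *\<^sub>v x)\<bar> \<le> c * (x \<bullet> x)"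
    and c: "0 \<le> c" and x: "x \<in> carrier_vec n" and norm_x: "x \<bullet> x \<le> 1"
  shows "vec_norm2 (A *\<^sub>v x) \<le> c"
proof (cases "vec_norm2 (A *\<^sub>v x) = 0")
  case True
  then show ?thesis using c by simp
next
  case False
  define r where "r = vec_norm2 (A *\<^sub>v x)"
  have r: "0 < r"
    using False vec_norm2_nonneg[of "A *\<^sub>v x"] by (simp add: r_def)
  have r2: "(A *\<^sub>v x) \<bullet> (A *\<^sub>v x) = r\<^sup>2"
    by (simp add: r_def vec_norm2_def scalar_prod_self_nonneg)
  \<comment> \<open>With \<open>A x\<close> normalized to \<open>y\<close>, the bilinear form at
    \<open>y\<close> and \<open>x\<close> is exactly the norm \<open>r\<close> to be
    bounded.\<close>
  define y where "y = (1 / r) \<cdot>\<^sub>v (A *\<^sub>v x)"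
  have Ax: "A *\<^sub>v x \<in> carrier_vec n"
    using A x by simp
  then have y: "y \<in> carrier_vec n"
    by (simp add: y_def)
  then have Ay: "A *\<^sub>v y \<in> carrier_vec n"
    using A by simp
  have yAx: "y \<bullet> (A *\<^sub>v x) = r" and yy: "y \<bullet> y = 1"
    using r Ax by (simp_all add: y_def r2 power2_eq_square)
  note comm = symmetric_bilinear_comm[OF A sym x y] comm_scalar_prod[OF y x]
  have "4 * r = (x + y) \<bullet> (A *\<^sub>v (x + y)) - (x - y) \<bullet> (A *\<^sub>v (x - y))"
    using A x y Ax Ay yAx comm
    by (simp add: mult_add_distrib_mat_vec mult_minus_distrib_mat_vec
        add_scalar_prod_distrib[of _ n] scalar_prod_add_distrib[of _ n]
        minus_scalar_prod_distrib[of _ n] scalar_prod_minus_distrib[of _ n])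
  also have "\<dots> \<le> c * ((x + y) \<bullet> (x + y)) + c * ((x - y) \<bullet> (x - y))"
    using bound[of "x + y"] bound[of "x - y"] x y by simp
  also have "\<dots> = c * (2 * (x \<bullet> x) + 2 * (y \<bullet> y))"
    using x y comm
    by (simp add: add_scalar_prod_distrib[of _ n] scalar_prod_add_distrib[of _ n]
        minus_scalar_prod_distrib[of _ n] scalar_prod_minus_distrib[of _ n] algebra_simps)
  also have "\<dots> \<le> c * 4"
    using c norm_x yy by (intro mult_left_mono) auto
  finally show ?thesis
    by (simp add: r_def)
qed

lemma spectral_norm_le_of_quadratic_form:
  assumes "A \<in> carrier_mat n n" and "transpose_mat A = A"
    and "\<And>x. x \<in> carrier_vec n \<Longrightarrow> \<bar>x \<bullet> (A *\<^sub>v x)\<bar> \<le> c * (x \<bullet> x)"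
    and "0 \<le> c"
  shows "spectral_norm A \<le> c"
  using assms by (intro spectral_norm_leI vec_norm2_mult_le_of_quadratic_form)

lemma quadratic_form_eq_sum:
  fixes A :: "'a :: comm_semiring_0 mat"
  assumes "A \<in> carrier_mat n n" "x \<in> carrier_vec n"
  shows "x \<bullet> (A *\<^sub>v x) = (\<Sum>i<n. \<Sum>j<n. x $ i * A $$ (i, j) * x $ j)"
  using assms by (simp add: scalar_prod_def sum_distrib_left atLeast0LessThan mult.assoc)

section \<open>Removing the diagonal of a positive semidefinite matrix\<close>

lemma mult_unit_vec_eq_col:
  fixes A :: "'a :: comm_semiring_1 mat"
  assumes "A \<in> carrier_mat m n" "i < n"
  shows "A *\<^sub>v unit_vec n i = col A i"
  using assms by (intro eq_vecI) (auto simp: scalar_prod_right_unit)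

lemma psd_mat_diag_nonneg:
  assumes "psd_mat n A" "i < n"
  shows "0 \<le> A $$ (i, i)"
proof -
  have "0 \<le> unit_vec n i \<bullet> (A *\<^sub>v unit_vec n i)"
    using assms by (simp add: psd_mat_def)
  moreover have "A \<in> carrier_mat n n"
    using assms by (simp add: psd_mat_def)
  ultimately show ?thesis
    using assms(2) by (simp add: mult_unit_vec_eq_col scalar_prod_left_unit[of _ n] col_carrier_vec)
qed

text \<open>The quadratic form at \<open>t e\<^sub>i + e\<^sub>j\<close> is affine in \<open>t\<close> when \<open>A\<close> vanishes at \<open>(i, i)\<close>.\<close>

lemma psd_mat_diag_zero:
  assumes A: "psd_mat n A" and i: "i < n" and j: "j < n" and zero: "A $$ (i, i) = 0"
  shows "A $$ (i, j) = 0"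
proof (rule ccontr)
  assume nz: "A $$ (i, j) \<noteq> 0"
  have carr: "A \<in> carrier_mat n n"
    using A by (simp add: psd_mat_def)
  have sym: "A $$ (j, i) = A $$ (i, j)"
    using A i j by (metis psd_mat_def index_transpose_mat(1) carrier_matD)
  have "i \<noteq> j"
    using nz zero by auto
  \<comment> \<open>The solution of \<open>2 * t * A $$ (i, j) + A $$ (j, j) = - 1\<close>, so that
    the form becomes negative.\<close>
  define t where "t = - (A $$ (j, j) + 1) / (2 * A $$ (i, j))"
  define x where "x = t \<cdot>\<^sub>v unit_vec n i + unit_vec n j"
  have x: "x \<in> carrier_vec n"
    by (simp add: x_def)
  have Ax: "A *\<^sub>v x = t \<cdot>\<^sub>v col A i + col A j"
    using carr i j
    by (simp add: x_def mult_add_distrib_mat_vec[OF carr] mult_mat_vec[OF carr] mult_unit_vec_eq_col[OF carr])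
  have "x \<bullet> (A *\<^sub>v x) = t * (A *\<^sub>v x) $ i + (A *\<^sub>v x) $ j"
    using carr i j x unfolding x_def
    by (subst add_scalar_prod_distrib[of _ n]) (auto simp: scalar_prod_left_unit[of _ n])
  also have "\<dots> = 2 * t * A $$ (i, j) + A $$ (j, j)"
    using carr i j by (simp add: Ax zero sym algebra_simps)
  also have "\<dots> = - 1"
    using nz by (simp add: t_def field_simps)
  finally show False
    using A x by (auto simp: psd_mat_def)
qed

lemma spectral_norm_psd_minus_diag_less:
  assumes psd: "psd_mat n S"
    and upper: "\<And>x. x \<in> carrier_vec n \<Longrightarrow> x \<bullet> (S *\<^sub>v x) \<le> c * (x \<bullet> x)"
    and c: "0 < c"
  shows "spectral_norm (S - mat_diag n (\<lambda>i. S $$ (i, i))) < c"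
proof -
  have S: "S \<in> carrier_mat n n" and symS: "transpose_mat S = S"
    and S_nonneg: "\<And>x. x \<in> carrier_vec n \<Longrightarrow> 0 \<le> x \<bullet> (S *\<^sub>v x)"
    using psd by (auto simp: psd_mat_def)
  have S_sym: "S $$ (j, i) = S $$ (i, j)" if "i < n" "j < n" for i j
    using symS S that by (metis index_transpose_mat(1) carrier_matD)
  define R where "R = S - mat_diag n (\<lambda>i. S $$ (i, i))"
  have R: "R \<in> carrier_mat n n"
    by (simp add: R_def minus_carrier_mat)
  have R_index: "R $$ (i, j) = (if i = j then 0 else S $$ (i, j))" if "i < n" "j < n" for i j
    using that S by (auto simp: R_def mat_diag_def)
  have R_sym: "transpose_mat R = R"
    using R S_sym by (intro eq_matI) (auto simp: R_index)
  \<comment> \<open>Passing to \<open>T\<close> turns the upper bound on \<open>S\<close> into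
    semidefiniteness, so a diagonal entry of \<open>S\<close> equal to \<open>c\<close> can be
    treated as a zero diagonal entry of \<open>T\<close>.\<close>
  define T where "T = c \<cdot>\<^sub>m 1\<^sub>m n - S"
  have T: "psd_mat n T"
    unfolding psd_mat_def
  proof (intro conjI ballI)
    show "transpose_mat T = T"
      using S S_sym by (intro eq_matI) (auto simp: T_def)
    show "0 \<le> x \<bullet> (T *\<^sub>v x)" if x: "x \<in> carrier_vec n" for x
    proof -
      have "T *\<^sub>v x = c \<cdot>\<^sub>v x - S *\<^sub>v x"
        using S x by (intro eq_vecI) (auto simp: T_def minus_mult_distrib_mat_vec[of _ n n]
            row_smult scalar_prod_left_unit[of _ n])
      then have "x \<bullet> (T *\<^sub>v x) = c * (x \<bullet> x) - x \<bullet> (S *\<^sub>v x)"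
        using S x by (simp add: scalar_prod_minus_distrib[of _ n])
      then show ?thesis
        using upper[OF x] by simp
    qed
  qed (use S in \<open>auto simp: T_def\<close>)
  have T_index: "T $$ (i, j) = (if i = j then c else 0) - S $$ (i, j)" if "i < n" "j < n" for i j
    using that S by (simp add: T_def)
  define I where "I = {i. i < n \<and> 0 < S $$ (i, i) \<and> S $$ (i, i) < c}"
  have R_zero: "R $$ (i, j) = 0" if "i < n" "j < n" "i \<notin> I" for i j
  proof -
    \<comment> \<open>Semidefiniteness of \<open>S\<close> and \<open>T\<close> confines
      \<open>S $$ (i, i)\<close> to the interval from 0 to \<open>c\<close>; outside
      \<open>I\<close> only the endpoints remain. Off the diagonal \<open>R\<close>,
      \<open>S\<close> and \<open>- T\<close> agree.\<close>
    have "S $$ (i, i) = 0 \<or> T $$ (i, i) = 0"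
      using that psd_mat_diag_nonneg[OF psd, of i] psd_mat_diag_nonneg[OF T, of i]
      by (auto simp: I_def T_index)
    then show ?thesis
      using that psd_mat_diag_zero[OF psd, of i j] psd_mat_diag_zero[OF T, of i j]
      by (auto simp: R_index T_index)
  qed
  \<comment> \<open>A maximum of finitely many numbers, each below \<open>c\<close>, is itself below
    \<open>c\<close>. The extra 0 covers empty \<open>I\<close> and makes \<open>b\<close>
    nonnegative.\<close>
  define b where "b = Max (insert 0 ((\<lambda>i. max (S $$ (i, i)) (c - S $$ (i, i))) ` I))"
  have fin: "finite I"
    by (simp add: I_def)
  have b_nonneg: "0 \<le> b"
    using fin by (simp add: b_def)
  have b_less: "b < c"
    unfolding b_def using fin c by (subst Max_less_iff) (auto simp: I_def)
  have "max (S $$ (i, i)) (c - S $$ (i, i)) \<le> b" if "i \<in> I" for i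
    unfolding b_def using fin that by (intro Max_ge) auto
  then have b_ge: "S $$ (i, i) \<le> b" "c - S $$ (i, i) \<le> b" if "i \<in> I" for i
    using that by fastforce+
  have "\<bar>x \<bullet> (R *\<^sub>v x)\<bar> \<le> b * (x \<bullet> x)" if x: "x \<in> carrier_vec n" for x
  proof -
    \<comment> \<open>Deleting the coordinates outside \<open>I\<close> leaves the form of
      \<open>R\<close> unchanged, since those rows and columns of \<open>R\<close> vanish, and
      afterwards the bounds by \<open>b\<close> are needed on \<open>I\<close> only.\<close>
    define y where "y = vec n (\<lambda>i. if i \<in> I then x $ i else 0)"
    have y: "y \<in> carrier_vec n"
      by (simp add: y_def)
    have yy: "y \<bullet> y = (\<Sum>i<n. (y $ i)\<^sup>2)"
      using y by (simp add: scalar_prod_def atLeast0LessThan power2_eq_square)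
    have "x \<bullet> (R *\<^sub>v x) = (\<Sum>i<n. \<Sum>j<n. x $ i * R $$ (i, j) * x $ j)"
      by (rule quadratic_form_eq_sum[OF R x])
    also have "\<dots> = (\<Sum>i<n. \<Sum>j<n. y $ i * R $$ (i, j) * y $ j)"
    proof (intro sum.cong refl)
      fix i j assume "i \<in> {..<n}" "j \<in> {..<n}"
      moreover have "R $$ (i, j) = R $$ (j, i)" if "i < n" "j < n"
        using R R_sym that by (metis index_transpose_mat(1) carrier_matD)
      ultimately show "x $ i * R $$ (i, j) * x $ j = y $ i * R $$ (i, j) * y $ j"
        using R_zero[of i j] R_zero[of j i] by (auto simp: y_def)
    qed
    also have "\<dots> = (\<Sum>i<n. \<Sum>j<n. y $ i * S $$ (i, j) * y $ j
        - (if i = j then S $$ (i, i) * (y $ i)\<^sup>2 else 0))"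
      by (intro sum.cong refl) (auto simp: R_index power2_eq_square)
    also have "\<dots> = y \<bullet> (S *\<^sub>v y) - (\<Sum>i<n. S $$ (i, i) * (y $ i)\<^sup>2)"
      by (simp add: quadratic_form_eq_sum[OF S y] sum_subtractf)
    finally have form: "x \<bullet> (R *\<^sub>v x) = y \<bullet> (S *\<^sub>v y) - (\<Sum>i<n. S $$ (i, i) * (y $ i)\<^sup>2)" .
    \<comment> \<open>Lower bound: the form of \<open>S\<close> is nonnegative, so only the diagonal
      sum can pull the form of \<open>R\<close> below zero.\<close>
    have "(\<Sum>i<n. S $$ (i, i) * (y $ i)\<^sup>2) \<le> (\<Sum>i<n. b * (y $ i)\<^sup>2)"
      using b_ge by (intro sum_mono) (auto simp: y_def intro!: mult_right_mono)
    then have lower: "- (b * (y \<bullet> y)) \<le> x \<bullet> (R *\<^sub>v x)"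
      using S_nonneg[OF y] by (simp add: form yy sum_distrib_left)
    \<comment> \<open>Upper bound: the form of \<open>S\<close> is at most
      \<open>c * (y \<bullet> y)\<close>, and the diagonal sum is subtracted from it.\<close>
    have "x \<bullet> (R *\<^sub>v x) \<le> (\<Sum>i<n. (c - S $$ (i, i)) * (y $ i)\<^sup>2)"
      using upper[OF y] by (simp add: form yy sum_distrib_left sum_subtractf left_diff_distrib)
    also have "\<dots> \<le> (\<Sum>i<n. b * (y $ i)\<^sup>2)"
      using b_ge by (intro sum_mono) (auto simp: y_def intro!: mult_right_mono)
    finally have "\<bar>x \<bullet> (R *\<^sub>v x)\<bar> \<le> b * (y \<bullet> y)"
      using lower by (simp add: yy sum_distrib_left abs_le_iff)
    also have "y \<bullet> y \<le> x \<bullet> x"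
      using x by (auto simp: scalar_prod_def y_def intro!: sum_mono)
    finally show ?thesis
      using b_nonneg by (simp add: mult_left_mono)
  qed
  then have "spectral_norm R \<le> b"
    using R R_sym b_nonneg by (intro spectral_norm_le_of_quadratic_form)
  then show ?thesis
    using b_less by (simp add: R_def)
qed

section \<open>Matrices given by an eigendecomposition\<close>

lemma left_cols_eq_mat:
  assumes "A \<in> carrier_mat m n" "k \<le> n"
  shows "left_cols k A = mat m k (\<lambda>(i, j). A $$ (i, j))"
  using assms by (intro eq_matI) (auto simp: left_cols_def mat_of_cols_index)

lemma right_cols_eq_mat:
  assumes "A \<in> carrier_mat m n" "k \<le> n"
  shows "right_cols k A = mat m (n - k) (\<lambda>(i, j). A $$ (i, k + j))"
  using assms by (intro eq_matI) (auto simp: right_cols_def mat_of_cols_index)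

lemma diag_congruence_index:
  fixes A :: "'a :: comm_semiring_1 mat"
  assumes "A \<in> carrier_mat m n" "i < m" "j < m"
  shows "(A * mat_diag n f * transpose_mat A) $$ (i, j) = (\<Sum>p<n. A $$ (i, p) * f p * A $$ (j, p))"
  using assms by (simp add: mat_diag_mult_right scalar_prod_def atLeast0LessThan)

lemma diag_congruence_carrier:
  assumes "A \<in> carrier_mat m n"
  shows "A * mat_diag n f * transpose_mat A \<in> carrier_mat m m"
  using assms by (metis mat_diag_dim mult_carrier_mat transpose_carrier_mat)

lemma diag_congruence_symmetric:
  fixes A :: "'a :: comm_semiring_1 mat"
  assumes "A \<in> carrier_mat m n"
  shows "transpose_mat (A * mat_diag n f * transpose_mat A) = A * mat_diag n f * transpose_mat A"
proof (rule eq_matI)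
  fix i j
  assume "i < dim_row (A * mat_diag n f * transpose_mat A)"
    "j < dim_col (A * mat_diag n f * transpose_mat A)"
  then have "i < m" "j < m"
    using assms by auto
  then show "transpose_mat (A * mat_diag n f * transpose_mat A) $$ (i, j)
      = (A * mat_diag n f * transpose_mat A) $$ (i, j)"
    using assms diag_congruence_carrier[OF assms, of f]
    by (simp add: diag_congruence_index[OF assms] mult.commute mult.left_commute del: index_mult_mat)
qed (use assms in auto)

text \<open>Moving the left factor \<open>A\<close> across the scalar product leaves a diagonal form
  in the coordinates \<open>transpose_mat A *\<^sub>v x\<close>.\<close>

lemma diag_congruence_quadratic_form:
  fixes A :: "real mat"
  assumes A: "A \<in> carrier_mat m n" and x: "x \<in> carrier_vec m"
  shows "x \<bullet> ((A * mat_diag n f * transpose_mat A) *\<^sub>v x)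
    = (\<Sum>p<n. f p * ((transpose_mat A *\<^sub>v x) $ p)\<^sup>2)"
proof -
  define y where "y = transpose_mat A *\<^sub>v x"
  have y: "y \<in> carrier_vec n"
    using A x by (simp add: y_def)
  have "(A * mat_diag n f * transpose_mat A) *\<^sub>v x = A *\<^sub>v (mat_diag n f *\<^sub>v y)"
    using assoc_mult_mat_vec[of "A * mat_diag n f" m n "transpose_mat A" m x]
      assoc_mult_mat_vec[OF A mat_diag_dim y] A x
    by (simp add: y_def mult_carrier_mat[OF A mat_diag_dim] del: assoc_mult_mat)
  then have "x \<bullet> ((A * mat_diag n f * transpose_mat A) *\<^sub>v x) = y \<bullet> (mat_diag n f *\<^sub>v y)"
    using transpose_vec_mult_scalar[OF A mult_mat_vec_carrier[OF mat_diag_dim y] x, of f]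
    by (simp add: y_def)
  also have "\<dots> = (\<Sum>p<n. f p * (y $ p)\<^sup>2)"
    unfolding quadratic_form_eq_sum[OF mat_diag_dim y]
  proof (intro sum.cong refl)
    fix i assume i: "i \<in> {..<n}"
    have "(\<Sum>j<n. y $ i * mat_diag n f $$ (i, j) * y $ j)
        = (\<Sum>j<n. if j = i then f i * (y $ i)\<^sup>2 else 0)"
      using i by (intro sum.cong refl) (auto simp: mat_diag_def power2_eq_square)
    then show "(\<Sum>j<n. y $ i * mat_diag n f $$ (i, j) * y $ j) = f i * (y $ i)\<^sup>2"
      using i by simp
  qed
  finally show ?thesis
    by (simp add: y_def)
qed

lemma psd_mat_diag_congruence:
  assumes A: "A \<in> carrier_mat m n" and f: "\<And>p. p < n \<Longrightarrow> 0 \<le> f p"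
  shows "psd_mat m (A * mat_diag n f * transpose_mat A)"
  unfolding psd_mat_def
proof (intro conjI ballI)
  show "0 \<le> x \<bullet> ((A * mat_diag n f * transpose_mat A) *\<^sub>v x)" if "x \<in> carrier_vec m" for x
    unfolding diag_congruence_quadratic_form[OF A that]
    using f by (intro sum_nonneg mult_nonneg_nonneg) auto
qed (fact diag_congruence_carrier[OF A] diag_congruence_symmetric[OF A])+

lemma orthonormal_quadratic_form_le:
  assumes V: "orthonormal_mat n V" and f: "\<And>p. p < n \<Longrightarrow> f p \<le> c" and x: "x \<in> carrier_vec n"
  shows "x \<bullet> ((V * mat_diag n f * transpose_mat V) *\<^sub>v x) \<le> c * (x \<bullet> x)"
proof -
  have carr: "V \<in> carrier_mat n n" and VVt: "V * transpose_mat V = 1\<^sub>m n"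
    using V by (auto simp: orthonormal_mat_def)
  have "x \<bullet> ((V * mat_diag n f * transpose_mat V) *\<^sub>v x)
      \<le> (\<Sum>p<n. c * ((transpose_mat V *\<^sub>v x) $ p)\<^sup>2)"
    unfolding diag_congruence_quadratic_form[OF carr x]
    using f by (intro sum_mono mult_right_mono) auto
  \<comment> \<open>The factor 1 makes the sum an instance of the same formula with constant
    spectrum 1, where the matrix is \<open>V * transpose_mat V\<close>, the identity. This is how
    the isometry of the transpose enters.\<close>
  also have "\<dots> = c * (\<Sum>p<n. 1 * ((transpose_mat V *\<^sub>v x) $ p)\<^sup>2)"
    by (simp add: sum_distrib_left)
  also have "\<dots> = c * (x \<bullet> ((V * mat_diag n (\<lambda>_. 1) * transpose_mat V) *\<^sub>v x))"
    unfolding diag_congruence_quadratic_form[OF carr x] ..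
  also have "\<dots> = c * (x \<bullet> x)"
    using carr x VVt by simp
  finally show ?thesis .
qed

lemma orthonormal_mult_diag_eigenvector:
  assumes V: "orthonormal_mat n V" and k: "k < n"
  shows "(V * mat_diag n f * transpose_mat V) *\<^sub>v col V k = f k \<cdot>\<^sub>v col V k"
proof -
  have carr: "V \<in> carrier_mat n n" and VtV: "transpose_mat V * V = 1\<^sub>m n"
    using V by (auto simp: orthonormal_mat_def)
  have "(V * mat_diag n f * transpose_mat V) * V = V * mat_diag n f * (transpose_mat V * V)"
    using assoc_mult_mat[OF mult_carrier_mat[OF carr mat_diag_dim] _ carr] carr
    by (simp del: assoc_mult_mat)
  also have "\<dots> = V * mat_diag n f"
    using right_mult_one_mat[OF mult_carrier_mat[OF carr mat_diag_dim]] by (simp add: VtV)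
  finally have "(V * mat_diag n f * transpose_mat V) *\<^sub>v col V k = col (V * mat_diag n f) k"
    using col_mult2[OF diag_congruence_carrier[OF carr] carr k] by metis
  also have "\<dots> = f k \<cdot>\<^sub>v col V k"
    using carr k by (intro eq_vecI) (auto simp: mat_diag_mult_right)
  finally show ?thesis .
qed

text \<open>The quadratic form gives the upper bound, and the unit eigenvector
  \<open>col V k\<close> attains it. Maximality of \<open>f k\<close> is assumed rather than
  monotonicity because the truncated spectrum used later begins with zeros.\<close>

lemma spectral_norm_orthonormal_diag:
  assumes V: "orthonormal_mat n V" and f: "\<And>p. p < n \<Longrightarrow> 0 \<le> f p" "\<And>p. p < n \<Longrightarrow> f p \<le> f k"
    and k: "k < n"
  shows "spectral_norm (V * mat_diag n f * transpose_mat V) = f k"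
proof (rule antisym)
  let ?A = "V * mat_diag n f * transpose_mat V"
  have carr: "V \<in> carrier_mat n n" and VtV: "transpose_mat V * V = 1\<^sub>m n"
    using V by (auto simp: orthonormal_mat_def)
  note A = diag_congruence_carrier[OF carr, of f] diag_congruence_symmetric[OF carr, of f]
  have bound: "\<bar>x \<bullet> (?A *\<^sub>v x)\<bar> \<le> f k * (x \<bullet> x)" if "x \<in> carrier_vec n" for x
    using orthonormal_quadratic_form_le[OF V f(2) that] psd_mat_diag_congruence[OF carr f(1)] that
    by (auto simp: psd_mat_def)
  show "spectral_norm ?A \<le> f k"
    using A bound f(1)[OF k] by (rule spectral_norm_le_of_quadratic_form)
  have "col V k \<bullet> col V k = (transpose_mat V * V) $$ (k, k)"
    using carr k by simp
  then have unit: "col V k \<bullet> col V k = 1"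
    using k VtV by simp
  have "f k = vec_norm2 (?A *\<^sub>v col V k)"
    using carr k f(1)[OF k]
    by (simp add: orthonormal_mult_diag_eigenvector[OF V k] vec_norm2_def unit real_sqrt_mult)
  also have "\<dots> \<le> spectral_norm ?A"
    using A(1) vec_norm2_mult_le_of_quadratic_form[OF A bound f(1)[OF k]] _ eq_refl[OF unit]
    by (rule spectral_norm_geI) (use carr in auto)
  finally show "f k \<le> spectral_norm ?A" .
qed

text \<open>If \<open>l k\<close> is 0, so are all later eigenvalues, and the matrix factors through
  the first \<open>k\<close> columns of \<open>V\<close>. If \<open>l k\<close> is positive, the
  range contains the first \<open>k + 1\<close> eigenvectors. Indices start at 0, so
  \<open>l k\<close> is the eigenvalue number \<open>k + 1\<close>.\<close>

lemma rank_orthonormal_diag_le_iff: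
  fixes V :: "real mat"
  assumes V: "orthonormal_mat n V" and k: "k < n"
    and sorted: "\<And>i j. i \<le> j \<Longrightarrow> j < n \<Longrightarrow> l j \<le> l i" and nonneg: "\<And>i. i < n \<Longrightarrow> 0 \<le> l i"
  shows "vec_space.rank n (V * mat_diag n l * transpose_mat V) \<le> k \<longleftrightarrow> l k = 0"
proof -
  let ?A = "V * mat_diag n l * transpose_mat V"
  interpret vec_space "TYPE(real)" n .
  have carr: "V \<in> carrier_mat n n" and VtV: "transpose_mat V * V = 1\<^sub>m n"
    using V by (auto simp: orthonormal_mat_def)
  note A = diag_congruence_carrier[OF carr, of l]
  show ?thesis
  proof
    assume zero: "l k = 0"
    have l0: "l p = 0" if "k \<le> p" "p < n" for p
      using that sorted[of k p] nonneg[of p] zero by simp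
    define L where "L = left_cols k V"
    have L: "L \<in> carrier_mat n k" "L = mat n k (\<lambda>(i, j). V $$ (i, j))"
      using left_cols_eq_mat[OF carr, of k] k by (auto simp: L_def)
    have "?A = L * mat_diag k l * transpose_mat L"
    proof (rule eq_matI)
      fix i j
      assume "i < dim_row (L * mat_diag k l * transpose_mat L)"
        "j < dim_col (L * mat_diag k l * transpose_mat L)"
      then have ij: "i < n" "j < n"
        using L by auto
      have "(\<Sum>p<n. V $$ (i, p) * l p * V $$ (j, p)) = (\<Sum>p<k. V $$ (i, p) * l p * V $$ (j, p))"
        using k l0 by (intro sum.mono_neutral_right) auto
      then show "?A $$ (i, j) = (L * mat_diag k l * transpose_mat L) $$ (i, j)"
        unfolding diag_congruence_index[OF carr ij] diag_congruence_index[OF L(1) ij]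
        using ij by (simp add: L(2))
    qed (use carr L in auto)
    also have "\<dots> = L * (mat_diag k l * transpose_mat L)"
      using assoc_mult_mat[OF L(1) mat_diag_dim, of "transpose_mat L"] L(1) by simp
    finally have "rank ?A \<le> rank L"
      using rank_mult_le[OF L(1), of "mat_diag k l * transpose_mat L" n] L(1)
        mult_carrier_mat[OF mat_diag_dim, of "transpose_mat L" k n l] by simp
    also have "\<dots> \<le> k"
      using L rank_le_nc by blast
    finally show "rank ?A \<le> k" .
  next
    assume rank: "rank ?A \<le> k"
    show "l k = 0"
    proof (rule ccontr)
      assume "l k \<noteq> 0"
      then have pos: "0 < l p" if "p \<le> k" for p
        using sorted[OF that k] nonneg[OF k] by simp
      define L where "L = left_cols (Suc k) V"
      have L: "L \<in> carrier_mat n (Suc k)" "L = mat n (Suc k) (\<lambda>(i, j). V $$ (i, j))"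
        using left_cols_eq_mat[OF carr, of "Suc k"] k by (auto simp: L_def)
      have col_L: "col L p = col V p" if "p \<le> k" for p
        using that carr k by (intro eq_vecI) (auto simp: L(2))
      \<comment> \<open>Dividing each eigenvector by its positive eigenvalue gives a preimage of it,
        so that \<open>?A * M\<close> is \<open>L\<close>, whose rank is
        \<open>Suc k\<close>.\<close>
      define M where "M = L * mat_diag (Suc k) (\<lambda>p. 1 / l p)"
      have M: "M \<in> carrier_mat n (Suc k)"
        unfolding M_def by (rule mult_carrier_mat[OF L(1) mat_diag_dim])
      have "transpose_mat L * L = 1\<^sub>m (Suc k)"
      proof (rule eq_matI)
        fix i j assume "i < dim_row (1\<^sub>m (Suc k))" "j < dim_col (1\<^sub>m (Suc k))"
        then have ij: "i \<le> k" "j \<le> k"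
          by auto
        then have "(transpose_mat L * L) $$ (i, j) = (transpose_mat V * V) $$ (i, j)"
          using L carr k col_L by simp
        then show "(transpose_mat L * L) $$ (i, j) = 1\<^sub>m (Suc k) $$ (i, j)"
          using ij k by (simp add: VtV)
      qed (use L in auto)
      then have "Suc k = rank L"
        using rank_left_invertible[OF L(1), of "transpose_mat L"] L by simp
      also have "L = ?A * M"
      proof (rule mat_col_eqI)
        fix p assume "p < dim_col (?A * M)"
        then have p: "p \<le> k"
          using M by auto
        have "col M p = (1 / l p) \<cdot>\<^sub>v col V p"
          unfolding M_def mat_diag_mult_right[OF L(1)]
          using p k carr by (intro eq_vecI) (auto simp: L(2))
        then have "col (?A * M) p = ?A *\<^sub>v ((1 / l p) \<cdot>\<^sub>v col V p)"
          using col_mult2[OF A M, of p] p by simp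
        also have "\<dots> = (1 / l p) \<cdot>\<^sub>v (l p \<cdot>\<^sub>v col V p)"
          using mult_mat_vec[OF A col_carrier_vec[OF _ carr]] p k
          by (simp add: orthonormal_mult_diag_eigenvector[OF V])
        also have "\<dots> = col V p"
          using pos[OF p] by (simp add: smult_smult_assoc)
        finally show "col L p = col (?A * M) p"
          using col_L[OF p] by simp
      qed (use L carr M in auto)
      also have "rank \<dots> \<le> rank ?A"
        using rank_mult_le[OF A M] .
      finally show False
        using rank by simp
    qed
  qed
qed

section \<open>Truncated eigendecomposition with diagonal correction\<close>

theorem proposition2p1:
  fixes n k :: nat
    and \<Sigma> V U D S R :: "real mat"
    and l :: "nat \<Rightarrow> real"
  assumes Sigma_psd: "psd_mat n \<Sigma>"
    and V_orth: "orthonormal_mat n V"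
    and l_sorted: "\<forall>i j. i \<le> j \<longrightarrow> j < n \<longrightarrow> l j \<le> l i"
    and l_nonneg: "\<forall>i<n. 0 \<le> l i"
    and eigendecomposition: "\<Sigma> = V * mat_diag n l * transpose_mat V"
    and k_le: "k \<le> n"
    and U_eq: "U = left_cols k V * mat_diag k (\<lambda>i. sqrt (l i))"
    and D_eq: "D = mat_diag n (\<lambda>i. \<Sigma> $$ (i, i) - (U * transpose_mat U) $$ (i, i))"
    and S_eq: "S = \<Sigma> - U * transpose_mat U"
    and R_eq: "R = \<Sigma> - (D + U * transpose_mat U)"
  shows "(S = right_cols k V * mat_diag (n - k) (\<lambda>i. l (k + i)) * transpose_mat (right_cols k V)
            \<and> psd_mat n S \<and> R = S - D)
    \<and> (\<Sigma> = D + U * transpose_mat U + R \<and> psd_mat n D)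
    \<and> (spectral_norm S = next_eigenvalue n l k
        \<and> spectral_norm R \<le> next_eigenvalue n l k
        \<and> (0 < next_eigenvalue n l k \<longrightarrow> spectral_norm R < next_eigenvalue n l k))
    \<and> ((next_eigenvalue n l k = 0 \<longleftrightarrow> vec_space.rank n \<Sigma> \<le> k)
        \<and> (next_eigenvalue n l k = 0 \<longrightarrow>
             D = 0\<^sub>m n n \<and> R = 0\<^sub>m n n \<and> \<Sigma> = U * transpose_mat U))
    \<and> (k < vec_space.rank n \<Sigma> \<longrightarrow>
        spectral_norm (\<Sigma> - (D + U * transpose_mat U)) < spectral_norm (\<Sigma> - U * transpose_mat U))"
proof -
  have V: "V \<in> carrier_mat n n"
    using V_orth by (simp add: orthonormal_mat_def)
  have \<Sigma>: "\<Sigma> \<in> carrier_mat n n"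
    using Sigma_psd by (simp add: psd_mat_def)
  have U: "U = mat n k (\<lambda>(i, p). V $$ (i, p) * sqrt (l p))"
    using k_le V by (auto simp: U_eq left_cols_eq_mat mat_diag_mult_right[of _ n])
  have "U \<in> carrier_mat n k"
    by (simp add: U)
  then have UU: "U * transpose_mat U \<in> carrier_mat n n"
    by (metis mult_carrier_mat transpose_carrier_mat)
  have UU_index: "(U * transpose_mat U) $$ (i, j) = (\<Sum>p<k. V $$ (i, p) * l p * V $$ (j, p))"
    if "i < n" "j < n" for i j
  proof -
    have "(U * transpose_mat U) $$ (i, j)
        = (\<Sum>p<k. V $$ (i, p) * sqrt (l p) * (V $$ (j, p) * sqrt (l p)))"
      using that by (simp add: U scalar_prod_def atLeast0LessThan)
    also have "\<dots> = (\<Sum>p<k. V $$ (i, p) * (sqrt (l p) * sqrt (l p)) * V $$ (j, p))"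
      by (simp only: mult_ac)
    also have "\<dots> = (\<Sum>p<k. V $$ (i, p) * l p * V $$ (j, p))"
      using l_nonneg k_le by (intro sum.cong) auto
    finally show ?thesis .
  qed
  \<comment> \<open>The spectrum of \<open>S\<close>: zeroing the first \<open>k\<close> eigenvalues
    keeps the full square matrix \<open>V\<close>, so the results for orthonormal \<open>V\<close>
    apply to \<open>S\<close> directly.\<close>
  define f where "f p = (if p < k then 0 else l p)" for p
  have S_index: "S $$ (i, j) = (\<Sum>p\<in>{k..<n}. V $$ (i, p) * l p * V $$ (j, p))"
    if "i < n" "j < n" for i j
  proof -
    have "S $$ (i, j) = (\<Sum>p<n. V $$ (i, p) * l p * V $$ (j, p))
        - (\<Sum>p<k. V $$ (i, p) * l p * V $$ (j, p))"
      using that UU diag_congruence_index[OF V that, of l]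
      by (simp add: S_eq UU_index eigendecomposition del: index_mult_mat)
    also have "\<dots> = (\<Sum>p\<in>{..<n} - {..<k}. V $$ (i, p) * l p * V $$ (j, p))"
      using k_le by (subst sum_diff) auto
    also have "{..<n} - {..<k} = {k..<n}"
      by auto
    finally show ?thesis .
  qed
  have S: "S \<in> carrier_mat n n"
    using UU by (simp add: S_eq minus_carrier_mat)
  have S_V: "S = V * mat_diag n f * transpose_mat V"
  proof (rule eq_matI)
    fix i j
    assume "i < dim_row (V * mat_diag n f * transpose_mat V)"
      "j < dim_col (V * mat_diag n f * transpose_mat V)"
    then have ij: "i < n" "j < n"
      using V by auto
    show "S $$ (i, j) = (V * mat_diag n f * transpose_mat V) $$ (i, j)"
      unfolding S_index[OF ij] diag_congruence_index[OF V ij]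
      by (rule sum.mono_neutral_cong_left) (auto simp: f_def)
  qed (use S V in auto)
  have right: "right_cols k V \<in> carrier_mat n (n - k)"
    using right_cols_eq_mat[OF V k_le] by simp
  have S_right: "S = right_cols k V * mat_diag (n - k) (\<lambda>i. l (k + i)) * transpose_mat (right_cols k V)"
    (is "_ = ?W")
  proof (rule eq_matI)
    fix i j assume "i < dim_row ?W" "j < dim_col ?W"
    then have ij: "i < n" "j < n"
      using right by auto
    show "S $$ (i, j) = ?W $$ (i, j)"
      unfolding S_index[OF ij] diag_congruence_index[OF right ij]
      using ij k_le
      by (intro sum.reindex_bij_witness[of _ "\<lambda>p. k + p" "\<lambda>p. p - k"])
        (auto simp: right_cols_eq_mat[OF V k_le])
  qed (use S right in auto)
  have f_nonneg: "0 \<le> f p" if "p < n" for p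
    using that l_nonneg by (simp add: f_def)
  \<comment> \<open>For \<open>k = n\<close> every \<open>f p\<close> with \<open>p < n\<close> is
    0, in agreement with the convention for the eigenvalue after the last.\<close>
  have f_le: "f p \<le> next_eigenvalue n l k" if "p < n" for p
    using that l_nonneg l_sorted by (auto simp: f_def next_eigenvalue_def)
  have S_psd: "psd_mat n S"
    unfolding S_V using V f_nonneg by (rule psd_mat_diag_congruence)
  \<comment> \<open>Identifies \<open>D\<close> as the diagonal of \<open>S\<close>, so that
    \<open>R\<close> is \<open>S\<close> with its diagonal removed, the situation of the strict norm
    bound.\<close>
  have D: "D = mat_diag n (\<lambda>i. S $$ (i, i))"
    using UU \<Sigma> unfolding D_eq S_eq mat_diag_def
    by (intro eq_matI) (auto simp del: index_mult_mat)
  have D_carrier: "D \<in> carrier_mat n n"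
    by (simp add: D)
  have R: "R = S - D"
    using \<Sigma> UU D_carrier by (intro eq_matI) (auto simp: R_eq S_eq)
  have decomposition: "\<Sigma> = D + U * transpose_mat U + R"
    using \<Sigma> UU D_carrier by (intro eq_matI) (auto simp: R_eq)
  \<comment> \<open>A diagonal matrix is a congruence by the identity, and the diagonal of the
    semidefinite \<open>S\<close> is nonnegative.\<close>
  have D_psd: "psd_mat n D"
    using psd_mat_diag_congruence[of "1\<^sub>m n" n n "\<lambda>i. S $$ (i, i)"] psd_mat_diag_nonneg[OF S_psd]
    by (simp add: D left_mult_one_mat[OF mat_diag_dim] right_mult_one_mat[OF mat_diag_dim])
  \<comment> \<open>The spectrum \<open>f\<close> is squeezed between 0 and the next eigenvalue,
    hence vanishes.\<close>
  have zero: "S = 0\<^sub>m n n" if "next_eigenvalue n l k = 0"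
  proof (rule eq_matI)
    fix i j assume "i < dim_row (0\<^sub>m n n)" "j < dim_col (0\<^sub>m n n)"
    moreover have "f p = 0" if "p < n" for p
      using f_nonneg[OF that] f_le[OF that] \<open>next_eigenvalue n l k = 0\<close> by simp
    ultimately show "S $$ (i, j) = 0\<^sub>m n n $$ (i, j)"
      using diag_congruence_index[OF V, of i j f] by (simp add: S_V del: index_mult_mat)
  qed (use S in auto)
  have zero_DR: "D = 0\<^sub>m n n" "R = 0\<^sub>m n n" if "next_eigenvalue n l k = 0"
  proof -
    show "D = 0\<^sub>m n n"
      using zero[OF that] by (auto simp: D mat_diag_def)
    then show "R = 0\<^sub>m n n"
      using zero[OF that] by (simp add: R)
  qed
  have norm_S: "spectral_norm S = next_eigenvalue n l k"
  proof (cases "k < n")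
    case True
    then have "next_eigenvalue n l k = f k"
      by (simp add: f_def next_eigenvalue_def)
    then show ?thesis
      using spectral_norm_orthonormal_diag[OF V_orth f_nonneg _ True] f_le by (simp add: S_V)
  next
    case False
    then have "next_eigenvalue n l k = 0"
      by (simp add: next_eigenvalue_def)
    then show ?thesis
      using zero spectral_norm_zero_mat by simp
  qed
  have norm_R: "spectral_norm R < next_eigenvalue n l k" if "0 < next_eigenvalue n l k"
    unfolding R D
  proof (rule spectral_norm_psd_minus_diag_less[OF S_psd _ that])
    show "x \<bullet> (S *\<^sub>v x) \<le> next_eigenvalue n l k * (x \<bullet> x)" if "x \<in> carrier_vec n" for x
      unfolding S_V using V_orth f_le that by (rule orthonormal_quadratic_form_le)
  qed
  have eig_nonneg: "0 \<le> next_eigenvalue n l k"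
    using l_nonneg by (simp add: next_eigenvalue_def)
  have norm_R_le: "spectral_norm R \<le> next_eigenvalue n l k"
    using eig_nonneg norm_R zero_DR spectral_norm_zero_mat by (cases "next_eigenvalue n l k = 0") auto
  have rank: "next_eigenvalue n l k = 0 \<longleftrightarrow> vec_space.rank n \<Sigma> \<le> k"
  proof (cases "k < n")
    case True
    then show ?thesis
      using rank_orthonormal_diag_le_iff[OF V_orth True, of l] l_sorted l_nonneg
      by (simp add: next_eigenvalue_def eigendecomposition)
  next
    case False
    then show ?thesis
      using vec_space.rank_le_nc[OF \<Sigma>] by (simp add: next_eigenvalue_def)
  qed
  have "\<Sigma> = U * transpose_mat U" if "next_eigenvalue n l k = 0"
    using decomposition zero_DR[OF that] UU by simp
  \<comment> \<open>The two errors are \<open>R\<close> and \<open>S\<close>. Rank above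
    \<open>k\<close> makes the next eigenvalue positive, and that eigenvalue is the norm of
    \<open>S\<close>.\<close>
  moreover have "spectral_norm (\<Sigma> - (D + U * transpose_mat U)) < spectral_norm (\<Sigma> - U * transpose_mat U)"
    if "k < vec_space.rank n \<Sigma>"
    unfolding R_eq[symmetric] S_eq[symmetric] norm_S
    using that rank eig_nonneg by (intro norm_R) auto
  ultimately show ?thesis
    using S_right S_psd R decomposition D_psd norm_S norm_R norm_R_le rank zero_DR by blast
qed

end
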